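(* Let $k_0\neq0$ be a real constant and let $g$ be a smooth function of $t$. For a smooth function $w=w(t,z)$ put, for $y\ne0$, $$u=y^2\,w(t,z)+\frac{g'}{2k_0},\qquad z=\frac1{y^2}\Big(x+\frac{g}{2k_0}\Big).$$ Then $u$ is invariant under $k_0\mathbf v_0+\mathbf x_g$, and $u$ solves the ZK equation $u_{xt}-(uu_x)_x-u_{yy}=0$ if and only if $$-2w+2zw_z-w_z^2+w_{zt}-(w+4z^2)w_{zz}=0.$$
   Context: $\mathbf v_0=2x\partial_x+y\partial_y+2u\partial_u$ and $\mathbf x_g=g\partial_x-g'\partial_u$ are vector fields on $(t,x,y,u)$-space ($'=d/dt$). A function $u(t,x,y)$ is invariant under a vector field if the field is tangent to its graph. *)

theory Defs
  imports "HOL-Analysis.Analysis"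
begin

(* Meant for open S: derivatives are taken in the ambient space. *)
primrec Ck_on :: "nat \<Rightarrow> 'a::euclidean_space set \<Rightarrow> ('a \<Rightarrow> 'b::real_normed_vector) \<Rightarrow> bool" where
  "Ck_on 0 S f \<longleftrightarrow> continuous_on S f"
| "Ck_on (Suc n) S f \<longleftrightarrow> (\<forall>p\<in>S. f differentiable (at p)) \<and>
     (\<forall>v. Ck_on n S (\<lambda>p. frechet_derivative f (at p) v))"

definition smooth_on :: "'a::euclidean_space set \<Rightarrow> ('a \<Rightarrow> 'b::real_normed_vector) \<Rightarrow> bool" where
  "smooth_on S f \<longleftrightarrow> (\<forall>n. Ck_on n S f)"

definition tangent_vector :: "'a::real_normed_vector set \<Rightarrow> 'a \<Rightarrow> 'a \<Rightarrow> bool" where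
  "tangent_vector S p v \<longleftrightarrow>
     (\<exists>c :: real \<Rightarrow> 'a. c 0 = p \<and> (\<forall>\<^sub>F s in nhds 0. c s \<in> S) \<and> (c has_vector_derivative v) (at 0))"

definition graph_over :: "(real \<times> real \<times> real) set \<Rightarrow> (real \<times> real \<times> real \<Rightarrow> real)
    \<Rightarrow> (real \<times> real \<times> real \<times> real) set" where
  "graph_over D u = {(t, x, y, u (t, x, y)) | t x y. (t, x, y) \<in> D}"

definition invariant_under :: "(real \<times> real \<times> real) set \<Rightarrow> (real \<times> real \<times> real \<Rightarrow> real)
    \<Rightarrow> (real \<times> real \<times> real \<times> real \<Rightarrow> real \<times> real \<times> real \<times> real) \<Rightarrow> bool" where
  "invariant_under D u V \<longleftrightarrow> (\<forall>p \<in> graph_over D u. tangent_vector (graph_over D u) p (V p))"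

(* Vector fields on (t,x,y,u)-space, given by their components along d/dt, d/dx, d/dy, d/du. *)
definition field_v0 :: "real \<times> real \<times> real \<times> real \<Rightarrow> real \<times> real \<times> real \<times> real" where
  "field_v0 = (\<lambda>(t, x, y, u). (0, 2 * x, y, 2 * u))"

definition field_x :: "(real \<Rightarrow> real) \<Rightarrow> real \<times> real \<times> real \<times> real \<Rightarrow> real \<times> real \<times> real \<times> real" where
  "field_x g = (\<lambda>(t, x, y, u). (0, g t, 0, - deriv g t))"

definition Dt :: "(real \<times> real \<times> real \<Rightarrow> real) \<Rightarrow> real \<times> real \<times> real \<Rightarrow> real" where
  "Dt f = (\<lambda>(t, x, y). deriv (\<lambda>s. f (s, x, y)) t)"

definition Dx :: "(real \<times> real \<times> real \<Rightarrow> real) \<Rightarrow> real \<times> real \<times> real \<Rightarrow> real" where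
  "Dx f = (\<lambda>(t, x, y). deriv (\<lambda>s. f (t, s, y)) x)"

definition Dy :: "(real \<times> real \<times> real \<Rightarrow> real) \<Rightarrow> real \<times> real \<times> real \<Rightarrow> real" where
  "Dy f = (\<lambda>(t, x, y). deriv (\<lambda>s. f (t, x, s)) y)"

definition solves_ZK :: "(real \<times> real \<times> real) set \<Rightarrow> (real \<times> real \<times> real \<Rightarrow> real) \<Rightarrow> bool" where
  "solves_ZK D u \<longleftrightarrow> smooth_on D u \<and>
     (\<forall>p\<in>D. Dt (Dx u) p - Dx (\<lambda>q. u q * Dx u q) p - Dy (Dy u) p = 0)"

definition D1 :: "(real \<times> real \<Rightarrow> real) \<Rightarrow> real \<times> real \<Rightarrow> real" where
  "D1 f = (\<lambda>(t, z). deriv (\<lambda>s. f (s, z)) t)"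

definition D2 :: "(real \<times> real \<Rightarrow> real) \<Rightarrow> real \<times> real \<Rightarrow> real" where
  "D2 f = (\<lambda>(t, z). deriv (\<lambda>s. f (t, s)) z)"

definition solves_reduced :: "(real \<times> real) set \<Rightarrow> (real \<times> real \<Rightarrow> real) \<Rightarrow> bool" where
  "solves_reduced W w \<longleftrightarrow> smooth_on W w \<and>
     (\<forall>(t, z)\<in>W. - 2 * w (t, z) + 2 * z * D2 w (t, z) - (D2 w (t, z))\<^sup>2 + D1 (D2 w) (t, z)
        - (w (t, z) + 4 * z\<^sup>2) * D2 (D2 w) (t, z) = 0)"

end

(* On D the chain rule gives u_x = w_z, u_xt = w_zt + g' w_zz / (2 k0 y^2),
   (u u_x)_x = w_z^2 + (y^2 w + g'/(2 k0)) w_zz / y^2 and u_yy = 2 w - 2 z w_z + 4 z^2 w_zz.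
   The terms with g' cancel, so the ZK expression at (t,x,y) equals the reduced one at (t,z); every
   point of W is reached with y = 1. *)
theory Submission
  imports Defs
begin

section \<open>Calculus of smooth functions\<close>

lemma Ck_on_SucD:
  assumes "Ck_on (Suc n) S f"
  shows "\<And>p. p \<in> S \<Longrightarrow> (f has_derivative frechet_derivative f (at p)) (at p)"
    and "\<And>v. Ck_on n S (\<lambda>p. frechet_derivative f (at p) v)"
  using assms by (auto simp: frechet_derivative_works)

text \<open>Openness makes the two functions agree in a neighbourhood of each point, hence they
  share their Frechet derivative there; induction passes this to all higher derivatives.\<close>

lemma Ck_on_cong:
  assumes "open S" and "\<And>p. p \<in> S \<Longrightarrow> f p = h p" and "Ck_on n S f"
  shows "Ck_on n S h"
  using assms(2,3)
proof (induction n arbitrary: f h)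
  case 0
  then show ?case by (auto cong: continuous_on_cong)
next
  case (Suc n)
  have der: "(h has_derivative frechet_derivative f (at p)) (at p)" if "p \<in> S" for p
    using has_derivative_transform_within_open[OF Ck_on_SucD(1)[OF Suc.prems(2) that]
        \<open>open S\<close> that] Suc.prems(1) by simp
  have "Ck_on n S (\<lambda>p. frechet_derivative h (at p) v)" for v
    using Suc.IH[OF _ Ck_on_SucD(2)[OF Suc.prems(2)]] frechet_derivative_at[OF der] by simp
  then show ?case using der by (auto intro: differentiableI)
qed

text \<open>Uniqueness of the derivative lets any explicit formula \<open>f'\<close> replace the
  choice term \<open>frechet_derivative\<close>. The closure lemmas below take their induction step
  through this rule, with \<open>f'\<close> read off from the matching differentiation rule.\<close>

lemma Ck_on_SucI:
  assumes "open S" and der: "\<And>p. p \<in> S \<Longrightarrow> (f has_derivative f' p) (at p)"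
    and "\<And>v. Ck_on n S (\<lambda>p. f' p v)"
  shows "Ck_on (Suc n) S f"
proof -
  have "Ck_on n S (\<lambda>p. frechet_derivative f (at p) v)" for v
    using Ck_on_cong[OF assms(1) _ assms(3)] frechet_derivative_at[OF der] by simp
  then show ?thesis using der by (auto intro: differentiableI)
qed

text \<open>Product, chain and quotient rules mix a function with its own derivative; this lowers
  the function to the order of the derivative so that the induction hypothesis applies to
  both.\<close>

lemma Ck_on_Suc_imp:
  assumes "Ck_on (Suc n) S f"
  shows "Ck_on n S f"
  using assms
proof (induction n arbitrary: f)
  case 0
  then show ?case
    by (simp add: continuous_at_imp_continuous_on differentiable_imp_continuous_within)
next
  case (Suc n)
  then show ?case by (subst Ck_on.simps(2)) (metis Ck_on.simps(2))
qed

lemma Ck_on_const: "Ck_on n S (\<lambda>_. c)"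
proof (induction n arbitrary: c)
  case (Suc n)
  then show ?case by simp
qed simp

text \<open>A bounded linear map is its own derivative at every point, so its directional
  derivatives are constants.\<close>

lemma Ck_on_bounded_linear:
  assumes "open S" "bounded_linear f"
  shows "Ck_on n S f"
proof (cases n)
  case 0
  then show ?thesis using assms(2) by (simp add: linear_continuous_on)
next
  case (Suc m)
  then show ?thesis
    using Ck_on_SucI[OF assms(1) bounded_linear_imp_has_derivative[OF assms(2)] Ck_on_const] by simp
qed

lemma Ck_on_bounded_linear_comp:
  assumes "open S" "bounded_linear l" "Ck_on n S f"
  shows "Ck_on n S (\<lambda>p. l (f p))"
  using assms(3)
proof (induction n arbitrary: f)
  case 0
  then show ?case
    using bounded_linear.continuous_on[OF assms(2)] by simp
next
  case (Suc n)
  show ?case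
  proof (rule Ck_on_SucI[OF assms(1)])
    show "((\<lambda>p. l (f p)) has_derivative (\<lambda>v. l (frechet_derivative f (at p) v))) (at p)"
      if "p \<in> S" for p
      by (rule bounded_linear.has_derivative[OF assms(2) Ck_on_SucD(1)[OF Suc.prems that]])
  qed (rule Suc.IH[OF Ck_on_SucD(2)[OF Suc.prems]])
qed

lemma Ck_on_add:
  assumes "open S" "Ck_on n S f" "Ck_on n S h"
  shows "Ck_on n S (\<lambda>p. f p + h p)"
  using assms(2,3)
proof (induction n arbitrary: f h)
  case 0
  then show ?case by (simp add: continuous_on_add)
next
  case (Suc n)
  show ?case
  proof (rule Ck_on_SucI[OF assms(1)])
    show "((\<lambda>p. f p + h p) has_derivative
        (\<lambda>v. frechet_derivative f (at p) v + frechet_derivative h (at p) v)) (at p)"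
      if "p \<in> S" for p
      by (rule has_derivative_add[OF Ck_on_SucD(1)[OF Suc.prems(1) that] Ck_on_SucD(1)[OF Suc.prems(2) that]])
  qed (rule Suc.IH[OF Ck_on_SucD(2)[OF Suc.prems(1)] Ck_on_SucD(2)[OF Suc.prems(2)]])
qed

lemma Ck_on_sum:
  assumes "open S" "\<And>i. i \<in> I \<Longrightarrow> Ck_on n S (f i)"
  shows "Ck_on n S (\<lambda>p. \<Sum>i\<in>I. f i p)"
  using assms(2)
  by (induction I rule: infinite_finite_induct) (auto intro: Ck_on_const Ck_on_add[OF assms(1)])

text \<open>Induction on the order by the Leibniz rule. The general bilinear form serves both
  multiplication and \<open>scaleR\<close>, the latter for the chain rule.\<close>

lemma Ck_on_bounded_bilinear:
  assumes B: "bounded_bilinear B" and "open S" "Ck_on n S f" "Ck_on n S h"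
  shows "Ck_on n S (\<lambda>p. B (f p) (h p))"
  using assms(3,4)
proof (induction n arbitrary: f h)
  case 0
  then show ?case by (simp add: bounded_bilinear.continuous_on[OF B])
next
  case (Suc n)
  show ?case
  proof (rule Ck_on_SucI[OF assms(2)])
    show "((\<lambda>p. B (f p) (h p)) has_derivative
        (\<lambda>v. B (f p) (frechet_derivative h (at p) v) + B (frechet_derivative f (at p) v) (h p))) (at p)"
      if "p \<in> S" for p
      by (rule bounded_bilinear.FDERIV[OF B Ck_on_SucD(1)[OF Suc.prems(1) that]
          Ck_on_SucD(1)[OF Suc.prems(2) that]])
    show "Ck_on n S (\<lambda>p. B (f p) (frechet_derivative h (at p) v) + B (frechet_derivative f (at p) v) (h p))"
      for v
      by (intro Ck_on_add Suc.IH Ck_on_SucD(2)[OF Suc.prems(1)] Ck_on_SucD(2)[OF Suc.prems(2)]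
          Ck_on_Suc_imp[OF Suc.prems(1)] Ck_on_Suc_imp[OF Suc.prems(2)] assms(2))
  qed
qed

text \<open>\<open>Ck_on\<close> controls the derivative of \<open>f\<close> in fixed directions
  only, whereas the chain rule feeds it a direction that moves with \<open>p\<close>. Expanding that
  direction over \<open>Basis\<close> gives a finite sum of products: a coordinate of the derivative
  of \<open>h\<close>, times a fixed-direction derivative of \<open>f\<close> composed with
  \<open>h\<close>. The second factor falls under the induction hypothesis.\<close>

lemma Ck_on_compose:
  assumes "open S" "\<And>p. p \<in> S \<Longrightarrow> h p \<in> R" "Ck_on n R f" "Ck_on n S h"
  shows "Ck_on n S (\<lambda>p. f (h p))"
  using assms(3,4)
proof (induction n arbitrary: f)
  case 0
  then show ?case using continuous_on_compose2[of R f S h] assms(2) by auto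
next
  case (Suc n)
  let ?f' = "\<lambda>q. frechet_derivative f (at q)" and ?h' = "\<lambda>p. frechet_derivative h (at p)"
  show ?case
  proof (rule Ck_on_SucI[OF assms(1)])
    show "((\<lambda>p. f (h p)) has_derivative (\<lambda>v. \<Sum>b\<in>Basis. (?h' p v \<bullet> b) *\<^sub>R ?f' (h p) b)) (at p)"
      if "p \<in> S" for p
    proof -
      have f: "(f has_derivative ?f' (h p)) (at (h p))"
        by (rule Ck_on_SucD(1)[OF Suc.prems(1) assms(2)[OF that]])
      have expand: "?f' (h p) x = (\<Sum>b\<in>Basis. (x \<bullet> b) *\<^sub>R ?f' (h p) b)" for x
      proof -
        have lin: "linear (?f' (h p))"
          by (rule has_derivative_linear[OF f])
        have "?f' (h p) x = ?f' (h p) (\<Sum>b\<in>Basis. (x \<bullet> b) *\<^sub>R b)"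
          by (simp add: euclidean_representation)
        also have "\<dots> = (\<Sum>b\<in>Basis. (x \<bullet> b) *\<^sub>R ?f' (h p) b)"
          by (simp add: linear_sum[OF lin] linear_scale[OF lin])
        finally show ?thesis .
      qed
      show ?thesis
        using has_derivative_compose[OF Ck_on_SucD(1)[OF Suc.prems(2) that] f]
        by (subst (asm) expand)
    qed
    show "Ck_on n S (\<lambda>p. \<Sum>b\<in>Basis. (?h' p v \<bullet> b) *\<^sub>R ?f' (h p) b)" for v
      by (intro Ck_on_sum Ck_on_bounded_bilinear[OF bounded_bilinear_scaleR] assms(1)
          Ck_on_bounded_linear_comp[OF _ bounded_linear_inner_left]
          Suc.IH[OF Ck_on_SucD(2)[OF Suc.prems(1)]]
          Ck_on_SucD(2)[OF Suc.prems(2)] Ck_on_Suc_imp[OF Suc.prems(2)])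
  qed
qed

text \<open>The derivative of the reciprocal is built from the reciprocal itself and the derivative
  of \<open>f\<close>, so the induction closes on products.\<close>

lemma Ck_on_inverse:
  fixes f :: "'a::euclidean_space \<Rightarrow> 'b::real_normed_field"
  assumes "open S" "\<And>p. p \<in> S \<Longrightarrow> f p \<noteq> 0" "Ck_on n S f"
  shows "Ck_on n S (\<lambda>p. inverse (f p))"
  using assms(3)
proof (induction n)
  case 0
  then show ?case by (auto intro!: continuous_on_inverse assms(2))
next
  case (Suc n)
  show ?case
  proof (rule Ck_on_SucI[OF assms(1)])
    show "((\<lambda>p. inverse (f p)) has_derivative
        (\<lambda>v. - (inverse (f p) * frechet_derivative f (at p) v * inverse (f p)))) (at p)"
      if "p \<in> S" for p
      by (rule Deriv.has_derivative_inverse[OF assms(2)[OF that] Ck_on_SucD(1)[OF Suc.prems that]])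
    show "Ck_on n S (\<lambda>p. - (inverse (f p) * frechet_derivative f (at p) v * inverse (f p)))" for v
      by (intro Ck_on_bounded_linear_comp[OF assms(1), of uminus]
          Ck_on_bounded_bilinear[OF bounded_bilinear_mult] bounded_linear_minus[OF bounded_linear_ident]
          assms(1) Suc.IH[OF Ck_on_Suc_imp[OF Suc.prems]] Ck_on_SucD(2)[OF Suc.prems])
  qed
qed

section \<open>Closure properties of smooth functions\<close>

lemma smooth_on_bounded_linear: "open S \<Longrightarrow> bounded_linear f \<Longrightarrow> smooth_on S f"
  and smooth_on_const: "smooth_on S (\<lambda>_. c)"
  and smooth_on_add: "open S \<Longrightarrow> smooth_on S f1 \<Longrightarrow> smooth_on S f2 \<Longrightarrow> smooth_on S (\<lambda>p. f1 p + f2 p)"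
  by (simp_all add: smooth_on_def Ck_on_bounded_linear Ck_on_const Ck_on_add)

lemma smooth_on_mult:
  fixes f h :: "'a::euclidean_space \<Rightarrow> 'b::real_normed_algebra"
  shows "open S \<Longrightarrow> smooth_on S f \<Longrightarrow> smooth_on S h \<Longrightarrow> smooth_on S (\<lambda>p. f p * h p)"
  by (simp add: smooth_on_def Ck_on_bounded_bilinear[OF bounded_bilinear_mult])

lemma smooth_on_inverse:
  fixes f :: "'a::euclidean_space \<Rightarrow> 'b::real_normed_field"
  shows "open S \<Longrightarrow> (\<And>p. p \<in> S \<Longrightarrow> f p \<noteq> 0) \<Longrightarrow> smooth_on S f \<Longrightarrow> smooth_on S (\<lambda>p. inverse (f p))"
  by (simp add: smooth_on_def Ck_on_inverse)

lemma smooth_on_compose: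
  "open S \<Longrightarrow> smooth_on R f \<Longrightarrow> smooth_on S h \<Longrightarrow> (\<And>p. p \<in> S \<Longrightarrow> h p \<in> R) \<Longrightarrow>
    smooth_on S (\<lambda>p. f (h p))"
  unfolding smooth_on_def using Ck_on_compose by blast

lemma smooth_on_cong:
  "open S \<Longrightarrow> smooth_on S f \<Longrightarrow> (\<And>p. p \<in> S \<Longrightarrow> f p = h p) \<Longrightarrow> smooth_on S h"
  unfolding smooth_on_def using Ck_on_cong by blast

text \<open>A pair is the sum of its images under the two linear embeddings into the product, which
  reduces the claim to sums and bounded linear maps.\<close>

lemma smooth_on_Pair:
  assumes "open S" "smooth_on S f" "smooth_on S h"
  shows "smooth_on S (\<lambda>p. (f p, h p))"
proof -
  have "smooth_on S (\<lambda>p. (f p, 0) + (0, h p))"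
    unfolding smooth_on_def
  proof (intro allI Ck_on_add assms(1))
    show "Ck_on n S (\<lambda>p. (f p, 0))" for n
      using assms Ck_on_bounded_linear_comp[of S "\<lambda>x. (x, 0)" n f]
      by (simp add: smooth_on_def bounded_linear_Pair bounded_linear_ident bounded_linear_zero)
    show "Ck_on n S (\<lambda>p. (0, h p))" for n
      using assms Ck_on_bounded_linear_comp[of S "\<lambda>x. (0, x)" n h]
      by (simp add: smooth_on_def bounded_linear_Pair bounded_linear_ident bounded_linear_zero)
  qed
  then show ?thesis by simp
qed

lemma smooth_on_imp_continuous_on: "smooth_on S f \<Longrightarrow> continuous_on S f"
  unfolding smooth_on_def using Ck_on.simps(1) by blast

lemma smooth_on_imp_differentiable: "smooth_on S f \<Longrightarrow> p \<in> S \<Longrightarrow> f differentiable (at p)"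
  unfolding smooth_on_def by (metis Ck_on.simps(2))

lemma smooth_on_frechet_derivative:
  "smooth_on S f \<Longrightarrow> smooth_on S (\<lambda>p. frechet_derivative f (at p) v)"
  unfolding smooth_on_def by (metis Ck_on.simps(2))

text \<open>On the real line the Frechet derivative is multiplication by its value at 1, and that
  value is \<open>deriv\<close>.\<close>

lemma smooth_on_deriv:
  fixes f :: "real \<Rightarrow> real"
  assumes "open S" "smooth_on S f"
  shows "smooth_on S (deriv f)"
proof (rule smooth_on_cong[OF assms(1) smooth_on_frechet_derivative[OF assms(2)]])
  fix p assume "p \<in> S"
  then have "(f has_derivative frechet_derivative f (at p)) (at p)"
    using smooth_on_imp_differentiable[OF assms(2)] by (simp add: frechet_derivative_works)
  moreover have "frechet_derivative f (at p) h = frechet_derivative f (at p) 1 * h" for h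
    using linear_scale[OF has_derivative_linear[OF calculation], of h 1] by simp
  then have "frechet_derivative f (at p) = (*) (frechet_derivative f (at p) 1)"
    by (rule ext)
  ultimately have "(f has_field_derivative frechet_derivative f (at p) 1) (at p)"
    unfolding has_field_derivative_def by argo
  then show "frechet_derivative f (at p) 1 = deriv f p"
    by (simp add: DERIV_imp_deriv)
qed

section \<open>Partial derivatives and the chain rule along curves\<close>

lemma has_real_derivative_pair_frechet:
  fixes f :: "real \<times> real \<Rightarrow> real"
  assumes f: "f differentiable (at (a s, b s))"
    and a: "(a has_real_derivative a') (at s)" and b: "(b has_real_derivative b') (at s)"
  shows "((\<lambda>r. f (a r, b r)) has_real_derivative
    frechet_derivative f (at (a s, b s)) (1, 0) * a' +
    frechet_derivative f (at (a s, b s)) (0, 1) * b') (at s)"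
proof -
  let ?L = "frechet_derivative f (at (a s, b s))"
  have L: "(f has_derivative ?L) (at (a s, b s))"
    using f by (simp add: frechet_derivative_works)
  have lin: "linear ?L" by (rule has_derivative_linear[OF L])
  have "((\<lambda>r. (a r, b r)) has_derivative (\<lambda>h. (a' * h, b' * h))) (at s)"
    using a b by (intro has_derivative_Pair) (simp_all add: has_field_derivative_def)
  from has_derivative_compose[OF this L]
  have "((\<lambda>r. f (a r, b r)) has_derivative (\<lambda>h. ?L (a' * h, b' * h))) (at s)" .
  moreover have "?L (a' * h, b' * h) = (?L (1, 0) * a' + ?L (0, 1) * b') * h" for h
    using linear_add[OF lin, of "(a' * h) *\<^sub>R (1, 0)" "(b' * h) *\<^sub>R (0, 1)"]
      linear_scale[OF lin, of "a' * h" "(1, 0)"] linear_scale[OF lin, of "b' * h" "(0, 1)"]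
    by (simp add: algebra_simps)
  ultimately show ?thesis
    by (simp add: has_field_derivative_def)
qed

text \<open>The chain rule for curves, applied to the two coordinate lines through \<open>p\<close>.
  This links the partials, defined by one-variable limits, to the Frechet derivative that governs
  smoothness.\<close>

lemma partials_eq_frechet_derivative:
  assumes "f differentiable (at p)"
  shows D1_eq_frechet_derivative: "D1 f p = frechet_derivative f (at p) (1, 0)"
    and D2_eq_frechet_derivative: "D2 f p = frechet_derivative f (at p) (0, 1)"
proof -
  obtain t z where p: "p = (t, z)" by (cases p)
  show "D1 f p = frechet_derivative f (at p) (1, 0)"
    using DERIV_imp_deriv[OF has_real_derivative_pair_frechet[of f "\<lambda>r. r" t "\<lambda>_. z" 1 0]] assms
    by (simp add: D1_def p)
  show "D2 f p = frechet_derivative f (at p) (0, 1)"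
    using DERIV_imp_deriv[OF has_real_derivative_pair_frechet[of f "\<lambda>_. t" z "\<lambda>r. r" 0 1]] assms
    by (simp add: D2_def p)
qed

lemma has_real_derivative_pair_compose:
  fixes f :: "real \<times> real \<Rightarrow> real"
  assumes "f differentiable (at (a s, b s))"
    and "(a has_real_derivative a') (at s)" and "(b has_real_derivative b') (at s)"
  shows "((\<lambda>r. f (a r, b r)) has_real_derivative D1 f (a s, b s) * a' + D2 f (a s, b s) * b') (at s)"
  using has_real_derivative_pair_frechet[OF assms] partials_eq_frechet_derivative[OF assms(1)]
  by simp

lemma smooth_on_D2:
  fixes f :: "real \<times> real \<Rightarrow> real"
  assumes "open S" "smooth_on S f"
  shows "smooth_on S (D2 f)"
  by (rule smooth_on_cong[OF assms(1) smooth_on_frechet_derivative[OF assms(2), of "(0, 1)"]])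
    (simp add: D2_eq_frechet_derivative smooth_on_imp_differentiable[OF assms(2)])

text \<open>For \<open>c = 2 * k0\<close> the map \<open>Z\<close> is the similarity variable; its
  partials in x, y, t are 1/y^2, -2Z/y and g'/(c y^2), and the chain rule does the rest. The
  function \<open>f\<close> is left arbitrary because both \<open>w\<close> and \<open>D2 w\<close>
  are differentiated this way.\<close>

lemma has_real_derivative_slices:
  fixes f :: "real \<times> real \<Rightarrow> real" and g :: "real \<Rightarrow> real" and c :: real
  defines "Z \<equiv> \<lambda>t x y. (x + g t / c) / y\<^sup>2"
  assumes "f differentiable (at (t, Z t x y))" "y \<noteq> 0" "(g has_real_derivative g') (at t)"
  shows "((\<lambda>s. f (t, Z t s y)) has_real_derivative D2 f (t, Z t x y) / y\<^sup>2) (at x)"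
    and "((\<lambda>s. f (t, Z t x s)) has_real_derivative - 2 * Z t x y / y * D2 f (t, Z t x y)) (at y)"
    and "((\<lambda>s. f (s, Z s x y)) has_real_derivative
      D1 f (t, Z t x y) + g' / (c * y\<^sup>2) * D2 f (t, Z t x y)) (at t)"
proof -
  have "((\<lambda>s. Z t s y) has_real_derivative 1 / y\<^sup>2) (at x)"
    unfolding Z_def using DERIV_cdivide[OF DERIV_add[OF DERIV_ident DERIV_const]] by simp
  from has_real_derivative_pair_compose[of f "\<lambda>_. t" x, OF _ DERIV_const this] assms(2)
  show "((\<lambda>s. f (t, Z t s y)) has_real_derivative D2 f (t, Z t x y) / y\<^sup>2) (at x)"
    by simp
  have "((\<lambda>s. Z t x s) has_real_derivative - 2 * Z t x y / y) (at y)"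
    unfolding Z_def using \<open>y \<noteq> 0\<close>
    by (auto intro!: derivative_eq_intros simp: field_simps eval_nat_numeral)
  from has_real_derivative_pair_compose[of f "\<lambda>_. t" y, OF _ DERIV_const this] assms(2)
  show "((\<lambda>s. f (t, Z t x s)) has_real_derivative - 2 * Z t x y / y * D2 f (t, Z t x y)) (at y)"
    by (simp add: mult.commute)
  have "((\<lambda>s. Z s x y) has_real_derivative (g' / c) / y\<^sup>2) (at t)"
    unfolding Z_def using DERIV_cdivide[OF DERIV_add[OF DERIV_const DERIV_cdivide[OF assms(4)]]] by simp
  from has_real_derivative_pair_compose[of f "\<lambda>r. r" t, OF _ DERIV_ident this] assms(2)
  show "((\<lambda>s. f (s, Z s x y)) has_real_derivative
      D1 f (t, Z t x y) + g' / (c * y\<^sup>2) * D2 f (t, Z t x y)) (at t)"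
    by (simp add: mult.commute)
qed

lemma open_slices:
  assumes "open (D :: (real \<times> real \<times> real) set)"
  shows "open {s. (s, x, y) \<in> D}" "open {s. (t, s, y) \<in> D}" "open {s. (t, x, s) \<in> D}"
  using open_vimage[OF assms, of "\<lambda>s. (s, x, y)"] open_vimage[OF assms, of "\<lambda>s. (t, s, y)"]
    open_vimage[OF assms, of "\<lambda>s. (t, x, s)"]
  by (simp_all add: vimage_def continuous_on_Pair continuous_on_const continuous_on_id)

text \<open>Coordinate slices of an open set are open, so a formula valid only on \<open>D\<close>
  still agrees with \<open>u\<close> near the point along each coordinate line and may be
  differentiated in its place.\<close>

lemma partial_derivative_eqI:
  fixes u f :: "real \<times> real \<times> real \<Rightarrow> real"
  assumes "open D" "(t, x, y) \<in> D" "\<And>q. q \<in> D \<Longrightarrow> u q = f q"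
  shows "((\<lambda>s. f (s, x, y)) has_real_derivative d) (at t) \<Longrightarrow> Dt u (t, x, y) = d"
    and "((\<lambda>s. f (t, s, y)) has_real_derivative d) (at x) \<Longrightarrow> Dx u (t, x, y) = d"
    and "((\<lambda>s. f (t, x, s)) has_real_derivative d) (at y) \<Longrightarrow> Dy u (t, x, y) = d"
  unfolding Dt_def Dx_def Dy_def prod.case
  by (rule DERIV_imp_deriv, erule has_field_derivative_transform_within_open,
      rule open_slices[OF assms(1)], use assms(2,3) in auto)+

section \<open>The reduction\<close>

theorem mainTheorem5:
  fixes k0 :: real and g :: "real \<Rightarrow> real" and w :: "real \<times> real \<Rightarrow> real"
    and T :: "real set" and W :: "(real \<times> real) set"
    and z u :: "real \<times> real \<times> real \<Rightarrow> real" and D :: "(real \<times> real \<times> real) set"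
  assumes k0: "k0 \<noteq> 0"
    and g: "open T" "smooth_on T g"
    and w: "open W" "W \<subseteq> T \<times> UNIV" "smooth_on W w"
    and z: "\<And>t x y. t \<in> T \<Longrightarrow> y \<noteq> 0 \<Longrightarrow> z (t, x, y) = 1 / y\<^sup>2 * (x + g t / (2 * k0))"
    and D: "D = {(t, x, y). t \<in> T \<and> y \<noteq> 0 \<and> (t, z (t, x, y)) \<in> W}"
    and u: "\<And>t x y. (t, x, y) \<in> D \<Longrightarrow>
              u (t, x, y) = y\<^sup>2 * w (t, z (t, x, y)) + deriv g t / (2 * k0)"
  shows "invariant_under D u (\<lambda>p. k0 *\<^sub>R field_v0 p + field_x g p) \<and>
         (solves_ZK D u \<longleftrightarrow> solves_reduced W w)"
proof -
  \<comment> \<open>\<open>z\<close> is prescribed only where \<open>t\<close> lies in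
    \<open>T\<close> and \<open>y\<close> is nonzero; \<open>Z\<close> is the same expression taken
    as a total function, which can be differentiated directly.\<close>
  define Z where "Z t x y = (x + g t / (2 * k0)) / y\<^sup>2" for t x y
  have D_iff: "(t, x, y) \<in> D \<longleftrightarrow> y \<noteq> 0 \<and> (t, Z t x y) \<in> W" for t x y
    using w(2) by (auto simp: D z Z_def)
  have D_T: "t \<in> T" "y \<noteq> 0" if "(t, x, y) \<in> D" for t x y
    using that by (auto simp: D)
  have u_eq: "u (t, x, y) = y\<^sup>2 * w (t, Z t x y) + deriv g t / (2 * k0)" if "(t, x, y) \<in> D" for t x y
    using u[OF that] D_T[OF that] by (simp add: z Z_def)
  have g_diff: "(g has_real_derivative deriv g t) (at t)" if "t \<in> T" for t
    using smooth_on_imp_differentiable[OF g(2) that]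
    by (simp add: DERIV_deriv_iff_real_differentiable)

  define E :: "(real \<times> real \<times> real) set" where "E = T \<times> UNIV \<times> (- {0})"
  \<comment> \<open>The similarity map to (t, z), spelled with products and \<open>inverse\<close>
    so that the closure rules for smoothness match its syntax. It is smooth on the open set
    \<open>E\<close>, and \<open>D\<close> is the preimage of \<open>W\<close> in \<open>E\<close>;
    hence \<open>D\<close> is open.\<close>
  define \<Phi> where "\<Phi> = (\<lambda>p. (fst p,
    inverse (snd (snd p) * snd (snd p)) * (fst (snd p) + g (fst p) * inverse (2 * k0))))"
  have "open E" unfolding E_def by (intro open_Times g(1)) auto
  have bl: "bounded_linear (\<lambda>p :: real \<times> real \<times> real. fst (snd p))"
    "bounded_linear (\<lambda>p :: real \<times> real \<times> real. snd (snd p))"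
    by (intro bounded_linear_compose[OF bounded_linear_fst] bounded_linear_compose[OF bounded_linear_snd]
        bounded_linear_snd)+
  have sm_\<Phi>: "smooth_on E \<Phi>"
    unfolding \<Phi>_def
    by (intro smooth_on_Pair smooth_on_mult smooth_on_inverse smooth_on_add smooth_on_const \<open>open E\<close>
        smooth_on_compose[OF \<open>open E\<close> g(2)]
        smooth_on_bounded_linear[OF _ bl(1)] smooth_on_bounded_linear[OF _ bl(2)]
        smooth_on_bounded_linear[OF _ bounded_linear_fst])
      (auto simp: E_def)
  have \<Phi>: "\<Phi> (t, x, y) = (t, Z t x y)" for t x y
    by (simp add: \<Phi>_def Z_def power2_eq_square field_simps)
  have D_E: "D = E \<inter> \<Phi> -` W"
    using D_T by (auto simp: D_iff E_def \<Phi>)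
  have "open D"
    unfolding D_E using continuous_open_preimage[OF smooth_on_imp_continuous_on[OF sm_\<Phi>] \<open>open E\<close> w(1)] .
  \<comment> \<open>Smoothness of \<open>u\<close> is part of \<open>solves_ZK\<close> and follows
    from that of \<open>w\<close> and \<open>g\<close> alone, without any equation.\<close>
  have sm_u: "smooth_on D u"
  proof (rule smooth_on_cong[OF \<open>open D\<close>])
    let ?f = "\<lambda>p. snd (snd p) * snd (snd p) * w (\<Phi> p) + deriv g (fst p) * inverse (2 * k0)"
    have \<Phi>_D: "smooth_on D \<Phi>"
      by (rule smooth_on_compose[OF \<open>open D\<close> sm_\<Phi>
          smooth_on_bounded_linear[OF \<open>open D\<close> bounded_linear_ident]]) (simp add: D_E)
    show "smooth_on D ?f"
      by (intro smooth_on_mult smooth_on_add smooth_on_const \<open>open D\<close>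
        smooth_on_compose[OF \<open>open D\<close> w(3) \<Phi>_D] smooth_on_compose[OF \<open>open D\<close> smooth_on_deriv[OF g]]
        smooth_on_bounded_linear[OF _ bl(1)] smooth_on_bounded_linear[OF _ bl(2)]
        smooth_on_bounded_linear[OF _ bounded_linear_fst])
        (auto simp: D_E E_def)
    show "?f p = u p" if "p \<in> D" for p
      using that by (cases p) (simp add: u_eq \<Phi> power2_eq_square divide_inverse[symmetric])
  qed

  \<comment> \<open>The derivatives of \<open>u\<close> and the ZK expression in similarity
    form\<close>
  have diff: "f differentiable (at (t, Z t x y))" if "smooth_on W f" "(t, x, y) \<in> D" 
    for f :: "real \<times> real \<Rightarrow> real" and t x y
    using that by (auto simp: D_iff intro: smooth_on_imp_differentiable)
  note slices = has_real_derivative_slices[where g = g and c = "2 * k0", folded Z_def,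
      OF diff D_T(2) g_diff[OF D_T(1)]]
  have sm_w2: "smooth_on W (D2 w)"
    by (rule smooth_on_D2[OF w(1,3)])

  \<comment> \<open>\<open>F\<close>, \<open>P\<close> and \<open>Q\<close> are closed formulas for
    u, u_x and u_y. Each agrees with its target on the open set \<open>D\<close>, so the next
    derivative can be taken from the formula.\<close>
  define F where "F = (\<lambda>(t, x, y). y\<^sup>2 * w (t, Z t x y) + deriv g t / (2 * k0))"
  have u_F: "u q = F q" if "q \<in> D" for q
    using that by (cases q) (auto simp: u_eq F_def)
  define P where "P = (\<lambda>(t, x, y). D2 w (t, Z t x y))"
  have Dx_u: "Dx u q = P q" if q: "q \<in> D" for q
  proof -
    obtain t x y where txy: "q = (t, x, y)" by (cases q)
    note q = q[unfolded txy]
    show ?thesis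
      unfolding txy P_def prod.case
      by (rule partial_derivative_eqI(2)[OF \<open>open D\<close> q u_F]; simp add: F_def)
        (use D_T(2)[OF q] in \<open>auto intro!: derivative_eq_intros slices(1)[OF w(3) q q q]\<close>)
  qed
  \<comment> \<open>From 2 y w + y^2 (-2 Z / y) w_z, with 2 y factored out.\<close>
  define Q where "Q = (\<lambda>(t, x, y). 2 * y * (w (t, Z t x y) - Z t x y * D2 w (t, Z t x y)))"
  have Dy_u: "Dy u q = Q q" if q: "q \<in> D" for q
  proof -
    obtain t x y where txy: "q = (t, x, y)" by (cases q)
    note q = q[unfolded txy]
    show ?thesis
      unfolding txy Q_def prod.case
      by (rule partial_derivative_eqI(3)[OF \<open>open D\<close> q u_F]; simp add: F_def)
        (use D_T(2)[OF q] in \<open>auto intro!: derivative_eq_intros slices(2)[OF w(3) q q q]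
          simp: field_simps power2_eq_square\<close>)
  qed
  have ZK_eq: "Dt (Dx u) (t, x, y) - Dx (\<lambda>q. u q * Dx u q) (t, x, y) - Dy (Dy u) (t, x, y)
      = - 2 * w (t, \<zeta>) + 2 * \<zeta> * D2 w (t, \<zeta>) - (D2 w (t, \<zeta>))\<^sup>2 + D1 (D2 w) (t, \<zeta>)
        - (w (t, \<zeta>) + 4 * \<zeta>\<^sup>2) * D2 (D2 w) (t, \<zeta>)"
    if q: "(t, x, y) \<in> D" and \<zeta>: "\<zeta> = Z t x y" for t x y \<zeta>
  proof -
    note y = D_T(2)[OF q]
    have xt: "Dt (Dx u) (t, x, y) = D1 (D2 w) (t, \<zeta>) + deriv g t / (2 * k0 * y\<^sup>2) * D2 (D2 w) (t, \<zeta>)"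
      unfolding \<zeta> by (rule partial_derivative_eqI(1)[OF \<open>open D\<close> q Dx_u]; simp add: P_def)
        (rule slices(3)[OF sm_w2 q q q, simplified])
    have xx: "Dx (\<lambda>q. u q * Dx u q) (t, x, y) =
        (D2 w (t, \<zeta>))\<^sup>2 + (y\<^sup>2 * w (t, \<zeta>) + deriv g t / (2 * k0)) * (D2 (D2 w) (t, \<zeta>) / y\<^sup>2)"
      unfolding \<zeta>
    proof (rule partial_derivative_eqI(2)[OF \<open>open D\<close> q])
      show "u q * Dx u q = F q * P q" if "q \<in> D" for q
        using u_F[OF that] Dx_u[OF that] by simp
      show "((\<lambda>s. F (t, s, y) * P (t, s, y)) has_real_derivative (D2 w (t, Z t x y))\<^sup>2 +
          (y\<^sup>2 * w (t, Z t x y) + deriv g t / (2 * k0)) * (D2 (D2 w) (t, Z t x y) / y\<^sup>2)) (at x)"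
        unfolding F_def P_def prod.case using y
        by (auto intro!: derivative_eq_intros slices(1)[OF w(3) q q q] slices(1)[OF sm_w2 q q q]
            simp: power2_eq_square)
    qed
    \<comment> \<open>\<open>Z\<close> also occurs in \<open>Q\<close> as a bare factor. Its
      y-derivative cancels the w_z term coming from w inside the bracket of \<open>Q\<close>, which
      leaves (2 Z^2 / y) w_zz as the derivative of that bracket.\<close>
    have Z_y: "((\<lambda>s. Z t x s) has_real_derivative - 2 * Z t x y / y) (at y)"
      unfolding Z_def using y
      by (auto intro!: derivative_eq_intros simp: field_simps eval_nat_numeral)
    have yy: "Dy (Dy u) (t, x, y) = 2 * w (t, \<zeta>) - 2 * \<zeta> * D2 w (t, \<zeta>) + 4 * \<zeta>\<^sup>2 * D2 (D2 w) (t, \<zeta>)"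
      unfolding \<zeta>
      by (rule partial_derivative_eqI(3)[OF \<open>open D\<close> q Dy_u]; simp add: Q_def)
        (use y in \<open>auto intro!: derivative_eq_intros slices(2)[OF w(3) q q q] slices(2)[OF sm_w2 q q q] Z_y
          simp: field_simps power2_eq_square\<close>)
    show ?thesis
      unfolding xt xx yy using y k0 by (simp add: field_simps)
  qed

  \<comment> \<open>Equivalence of the two equations\<close>
  have "solves_ZK D u \<longleftrightarrow> solves_reduced W w"
  proof
    assume zk: "solves_ZK D u"
    show "solves_reduced W w"
      unfolding solves_reduced_def
    proof (intro conjI w(3) ballI, clarify)
      fix t \<zeta> assume "(t, \<zeta>) \<in> W"
      \<comment> \<open>At y = 1 the similarity variable is x + g/(2 k0); solving for x gives a
        preimage of the prescribed point of \<open>W\<close>.\<close>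
      moreover have "\<zeta> = Z t (\<zeta> - g t / (2 * k0)) 1"
        by (simp add: Z_def)
      ultimately show "- 2 * w (t, \<zeta>) + 2 * \<zeta> * D2 w (t, \<zeta>) - (D2 w (t, \<zeta>))\<^sup>2 + D1 (D2 w) (t, \<zeta>)
        - (w (t, \<zeta>) + 4 * \<zeta>\<^sup>2) * D2 (D2 w) (t, \<zeta>) = 0"
        using ZK_eq[of t "\<zeta> - g t / (2 * k0)" 1 \<zeta>] zk D_iff[of t "\<zeta> - g t / (2 * k0)" 1]
        by (simp add: solves_ZK_def)
    qed
  next
    assume red: "solves_reduced W w"
    show "solves_ZK D u"
      unfolding solves_ZK_def
    proof (intro conjI sm_u ballI, clarify)
      fix t x y assume q: "(t, x, y) \<in> D"
      show "Dt (Dx u) (t, x, y) - Dx (\<lambda>q. u q * Dx u q) (t, x, y) - Dy (Dy u) (t, x, y) = 0"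
        unfolding ZK_eq[OF q refl] using red q by (auto simp: solves_reduced_def D_iff)
    qed
  qed

  \<comment> \<open>Invariance under the vector field\<close>
  moreover have "invariant_under D u (\<lambda>p. k0 *\<^sub>R field_v0 p + field_x g p)"
    unfolding invariant_under_def
  proof
    fix p assume "p \<in> graph_over D u"
    then obtain t x y where q: "(t, x, y) \<in> D" and p: "p = (t, x, y, u (t, x, y))"
      by (auto simp: graph_over_def)
    \<comment> \<open>The flow of the field fixes \<open>t\<close> and \<open>z\<close>, so its orbits stay in the graph.\<close>
    define X where "X s = (x + g t / (2 * k0)) * exp (2 * k0 * s) - g t / (2 * k0)" for s
    define Y where "Y s = y * exp (k0 * s)" for s
    have e: "exp (2 * k0 * s) = (exp (k0 * s))\<^sup>2" for s
      by (simp add: exp_double[symmetric] mult.assoc)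
    \<comment> \<open>Both X + g/(2 k0) and Y^2 are scaled by exp(2 k0 s), so their quotient does
      not change.\<close>
    have Z_const: "Z t (X s) (Y s) = Z t x y" for s
      by (simp add: Z_def X_def Y_def e power_mult_distrib)
    have orbit: "(t, X s, Y s) \<in> D" for s
      using q by (simp add: D_iff Z_const) (simp add: Y_def)
    \<comment> \<open>The last component solves U' = 2 k0 U - g' with \<open>t\<close> frozen. Since
      \<open>Z\<close> is constant along the orbit, the value of \<open>w\<close> enters as a
      constant, and no derivative of \<open>w\<close> is needed; \<open>c_u\<close> then identifies
      this component with \<open>u\<close> on the orbit.\<close>
    define c where "c s = (t, X s, Y s, y\<^sup>2 * exp (2 * k0 * s) * w (t, Z t x y) + deriv g t / (2 * k0))" for s
    have c_u: "c s = (t, X s, Y s, u (t, X s, Y s))" for s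
      by (simp add: c_def u_eq[OF orbit] Z_const) (simp add: Y_def e power_mult_distrib)
    show "tangent_vector (graph_over D u) p (k0 *\<^sub>R field_v0 p + field_x g p)"
      unfolding tangent_vector_def
    proof (intro exI conjI)
      show "c 0 = p"
        unfolding c_u p by (simp add: X_def Y_def)
      show "\<forall>\<^sub>F s in nhds 0. c s \<in> graph_over D u"
        unfolding c_u graph_over_def using orbit by (intro always_eventually) blast
      have "(X has_real_derivative k0 * (2 * x) + g t) (at 0)"
        unfolding X_def using k0 by (auto intro!: derivative_eq_intros simp: field_simps)
      moreover have "(Y has_real_derivative k0 * y) (at 0)"
        unfolding Y_def by (auto intro!: derivative_eq_intros)
      moreover have "((\<lambda>s. y\<^sup>2 * exp (2 * k0 * s) * w (t, Z t x y) + deriv g t / (2 * k0))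
          has_real_derivative k0 * (2 * u (t, x, y)) - deriv g t) (at 0)"
        using k0 by (auto intro!: derivative_eq_intros simp: u_eq[OF q] field_simps)
      ultimately have "(c has_vector_derivative (0, k0 * (2 * x) + g t, k0 * y,
          k0 * (2 * u (t, x, y)) - deriv g t)) (at 0)"
        unfolding c_def
        by (intro has_vector_derivative_Pair)
          (simp_all add: has_real_derivative_iff_has_vector_derivative)
      then show "(c has_vector_derivative k0 *\<^sub>R field_v0 p + field_x g p) (at 0)"
        by (simp add: p field_v0_def field_x_def)
    qed
  qed
  ultimately show ?thesis by blast
qed

end
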